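(* Let $n\ge 1$ and $A=\{1,n\}$. (1) If $n$ is odd, the P-positions of $SN(n,A)$ are exactly the positions $\mathbf p$ with $\Sigma(\mathbf p)$ even. (2) If $n$ is even, the P-positions of $SN(n,A)$ are exactly the positions $\mathbf p$ with $\Sigma(\mathbf p)$ even and $p_1$ even, where $p_1=\min_i p_i$.
   Context: The game $SN(n,A)$, for nonempty $A\subseteq\{1,\dots,n\}$, is played on $n$ stacks of tokens; a position is $\mathbf p=(p_1,\dots,p_n)$ of nonnegative integers written in non-decreasing order (so $p_1$ is a minimal stack height). A move consists of choosing some $\ell\in A$ and $\ell$ distinct stacks, each of height at least $1$, and removing exactly one token from each. Players alternate; a player unable to move loses (normal play). A P-position is one from which the player to move loses under optimal play. $\Sigma(\mathbf p)=\sum_i p_i$. *)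

theory Defs
  imports Main
begin

text \<open>
  Outcome classes of a normal-play impartial game with move relation \<open>move\<close>. A position without
  moves is a P-position by the first rule. As a least fixed point, this says that the winner can
  force the win in finitely many moves; positions with infinite optimal play would be in neither
  class, but play in the games below is always finite.
\<close>

inductive P_position :: "('a \<Rightarrow> 'a \<Rightarrow> bool) \<Rightarrow> 'a \<Rightarrow> bool"
  and N_position :: "('a \<Rightarrow> 'a \<Rightarrow> bool) \<Rightarrow> 'a \<Rightarrow> bool"
  for move :: "'a \<Rightarrow> 'a \<Rightarrow> bool"
where
  P_positionI: "(\<forall>q. move p q \<longrightarrow> N_position move q) \<Longrightarrow> P_position move p"
| N_positionI: "move p q \<Longrightarrow> P_position move q \<Longrightarrow> N_position move p"

definition SN_positions :: "nat \<Rightarrow> nat list set" where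
  "SN_positions n = {p. length p = n \<and> sorted p}"

text \<open>The set \<open>S\<close> consists of the indices of the chosen stacks; the result is sorted again.\<close>

definition SN_move :: "nat \<Rightarrow> nat set \<Rightarrow> nat list \<Rightarrow> nat list \<Rightarrow> bool" where
  "SN_move n A p q \<longleftrightarrow>
    p \<in> SN_positions n \<and>
    (\<exists>l\<in>A. \<exists>S \<subseteq> {..<n}. card S = l \<and> (\<forall>i\<in>S. p ! i \<ge> 1) \<and>
       q = sort (map (\<lambda>i. if i \<in> S then p ! i - 1 else p ! i) [0..<n]))"

definition SN_P_positions :: "nat \<Rightarrow> nat set \<Rightarrow> nat list set" where
  "SN_P_positions n A = {p \<in> SN_positions n. P_position (SN_move n A) p}"

text \<open>Lists are indexed from 0, so the smallest stack height \<open>p\<^sub>1\<close> is \<open>p ! 0\<close>.\<close>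

lemma SN_positions_nth_0_eq_Min:
  assumes "p \<in> SN_positions n" "n \<ge> 1"
  shows "p ! 0 = Min (set p)"
proof -
  from assms have "p \<noteq> []" "sorted p" by (auto simp: SN_positions_def)
  then show ?thesis
    by (cases p) (auto intro!: Min_eqI[symmetric])
qed

end

theory Submission imports Defs "HOL-Library.Multiset" begin

text \<open>
  Removing one token changes the parity of the sum. Removing a token from every stack changes the
  parity of the sum if \<open>n\<close> is odd; if \<open>n\<close> is even it preserves it and changes the parity of the
  minimum. Hence no move joins two claimed P-positions. Conversely, from any other position:
  if \<open>n\<close> is even and the minimum is odd, play on a minimal stack or on all stacks,
  according to the parity of the sum; otherwise the sum is odd and one plays on an odd stack,
  which for even \<open>n\<close> is not minimal.
\<close>

text \<open>\<open>P_position\<close> and \<open>N_position\<close> are least fixed points, so they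
  are not complementary by definition. Induction on \<open>size\<close> therefore proves both
  equivalences at once, each feeding the other. \<open>X\<close> confines the claim to well-formed
  positions and must be closed under moves.\<close>

lemma P_position_iff:
  fixes size :: "'a \<Rightarrow> nat"
  assumes decreasing: "\<And>p q. move p q \<Longrightarrow> size q < size p"
    and closed: "\<And>p q. p \<in> X \<Longrightarrow> move p q \<Longrightarrow> q \<in> X"
    and stable: "\<And>p q. p \<in> X \<Longrightarrow> W p \<Longrightarrow> move p q \<Longrightarrow> \<not> W q"
    and absorbing: "\<And>p. p \<in> X \<Longrightarrow> \<not> W p \<Longrightarrow> \<exists>q. move p q \<and> W q"
    and "p \<in> X"
  shows "P_position move p \<longleftrightarrow> W p"
proof -
  have "(P_position move p \<longleftrightarrow> W p) \<and> (N_position move p \<longleftrightarrow> \<not> W p)"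
    using \<open>p \<in> X\<close>
  proof (induction p rule: measure_induct_rule[of size])
    case (less p)
    have IH: "(P_position move q \<longleftrightarrow> W q) \<and> (N_position move q \<longleftrightarrow> \<not> W q)" if "move p q" for q
      using less that decreasing closed by blast
    have "P_position move p \<longleftrightarrow> (\<forall>q. move p q \<longrightarrow> \<not> W q)"
      by (subst P_position.simps) (use IH in blast)
    moreover have "N_position move p \<longleftrightarrow> (\<exists>q. move p q \<and> W q)"
      by (subst N_position.simps) (use IH in blast)
    ultimately show ?case
      using stable absorbing less.prems by blast
  qed
  then show ?thesis ..
qed

text \<open>Makes the result of a move a function of the chosen index set, so that a winning move
  can be given by its set alone.\<close>

definition remove_tokens :: "nat \<Rightarrow> nat set \<Rightarrow> nat list \<Rightarrow> nat list" where
  "remove_tokens n S p = sort (map (\<lambda>i. if i \<in> S then p ! i - 1 else p ! i) [0..<n])"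

lemma SN_move_iff:
  "SN_move n A p q \<longleftrightarrow> p \<in> SN_positions n \<and>
     (\<exists>S \<subseteq> {..<n}. card S \<in> A \<and> (\<forall>i\<in>S. p ! i \<ge> 1) \<and> q = remove_tokens n S p)"
  unfolding SN_move_def remove_tokens_def by blast

lemma remove_tokens_in_SN_positions: "remove_tokens n S p \<in> SN_positions n"
  by (simp add: remove_tokens_def SN_positions_def)

text \<open>Stated additively to avoid truncated subtraction; the bound on chosen stacks makes each
  \<open>p ! i - 1\<close> a genuine predecessor.\<close>

lemma sum_list_remove_tokens:
  assumes "length p = n" "S \<subseteq> {..<n}" "\<forall>i\<in>S. p ! i \<ge> 1"
  shows "sum_list (remove_tokens n S p) + card S = sum_list p"
proof -
  let ?f = "\<lambda>i. if i \<in> S then p ! i - 1 else p ! i"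
  have "sum_list (remove_tokens n S p) = sum_list (map ?f [0..<n])"
    \<comment> \<open>Sorting keeps the multiset of heights, hence the sum.\<close>
    unfolding remove_tokens_def by (simp flip: sum_mset_sum_list)
  also have "\<dots> = (\<Sum>i<n. ?f i)"
    by (simp add: interv_sum_list_conv_sum_set_nat atLeast0LessThan)
  \<comment> \<open>\<open>card S\<close> becomes a sum of indicators, so that the two sums can be
    added termwise.\<close>
  finally have "sum_list (remove_tokens n S p) + card S = (\<Sum>i<n. ?f i) + (\<Sum>i<n. of_bool (i \<in> S))"
    using assms(2) by (simp add: sum_of_bool_eq Int_absorb1)
  also have "\<dots> = (\<Sum>i<n. p ! i)"
    unfolding sum.distrib[symmetric] using assms(3) by (intro sum.cong) auto
  also have "\<dots> = sum_list p"
    using assms(1) by (simp add: sum_list_sum_nth atLeast0LessThan)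
  finally show ?thesis .
qed

text \<open>Sorting loses the indices, so the new first entry is found as a minimum:
  \<open>m\<close> is a lower bound attained at \<open>j\<close>.\<close>

lemma remove_tokens_nth_0_eqI:
  assumes "j < n" "(if j \<in> S then p ! j - 1 else p ! j) = m"
    and "\<And>i. i < n \<Longrightarrow> m \<le> (if i \<in> S then p ! i - 1 else p ! i)"
  shows "remove_tokens n S p ! 0 = m"
proof -
  have "remove_tokens n S p ! 0 = Min (set (remove_tokens n S p))"
    using assms(1) by (intro SN_positions_nth_0_eq_Min[OF remove_tokens_in_SN_positions]) simp
  also have "\<dots> = m"
  proof (rule Min_eqI)
    show "m \<in> set (remove_tokens n S p)"
      unfolding remove_tokens_def assms(2)[symmetric] using assms(1) by simp
    show "m \<le> y" if "y \<in> set (remove_tokens n S p)" for y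
    proof -
      from that obtain i where "i < n" "y = (if i \<in> S then p ! i - 1 else p ! i)"
        by (auto simp: remove_tokens_def simp del: if_split)
      with assms(3) show ?thesis by metis
    qed
  qed simp
  finally show ?thesis .
qed

lemma SN_positions_nth_0_le: "p \<in> SN_positions n \<Longrightarrow> i < n \<Longrightarrow> p ! 0 \<le> p ! i"
  by (auto simp: SN_positions_def intro: sorted_nth_mono)

text \<open>Stack 0 is minimal and loses a token, while no other stack loses more than one. This
  covers both \<open>S = {0}\<close> and \<open>S = {..<n}\<close>.\<close>

lemma remove_tokens_nth_0:
  assumes "p \<in> SN_positions n" "n \<ge> 1" "0 \<in> S"
  shows "remove_tokens n S p ! 0 = p ! 0 - 1"
proof (rule remove_tokens_nth_0_eqI[of 0])
  fix i assume "i < n"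
  then show "p ! 0 - 1 \<le> (if i \<in> S then p ! i - 1 else p ! i)"
    using SN_positions_nth_0_le[OF assms(1), of i] by auto
qed (use assms in simp_all)

text \<open>Stack 0 is untouched, and stack \<open>i\<close>, being strictly higher, cannot drop
  below it.\<close>

lemma remove_token_nth_0_nonminimal:
  assumes "p \<in> SN_positions n" "i < n" "p ! 0 < p ! i"
  shows "remove_tokens n {i} p ! 0 = p ! 0"
  using assms SN_positions_nth_0_le[OF assms(1)]
  by (intro remove_tokens_nth_0_eqI[of 0]) auto

lemma SN_P_positions_1_n:
  assumes "n \<ge> 1"
  shows "SN_P_positions n {1, n} =
    {p \<in> SN_positions n. even (sum_list p) \<and> (even n \<longrightarrow> even (p ! 0))}"
proof -
  let ?W = "\<lambda>p. even (sum_list p) \<and> (even n \<longrightarrow> even (p ! 0))"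
  have "P_position (SN_move n {1, n}) p \<longleftrightarrow> ?W p" if "p \<in> SN_positions n" for p
  proof (rule P_position_iff[where size = sum_list and X = "SN_positions n"])
    fix p q assume "SN_move n {1, n} p q"
    then obtain S where S: "p \<in> SN_positions n" "S \<subseteq> {..<n}" "card S \<in> {1, n}"
        "\<forall>i\<in>S. p ! i \<ge> 1" "q = remove_tokens n S p"
      by (auto simp: SN_move_iff)
    have sum: "sum_list q + card S = sum_list p"
      using S sum_list_remove_tokens by (auto simp: SN_positions_def)
    with S(3) assms show "sum_list q < sum_list p" by auto
    show "q \<in> SN_positions n"
      using S(5) remove_tokens_in_SN_positions by simp
    show "\<not> ?W q" if "?W p"
    proof
      assume "?W q"
      \<comment> \<open>Both sums are even, so an even number of tokens was removed; this excludes a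
        single token and leaves the move on all stacks.\<close>
      with that sum have "even (card S)" by presburger
      with S(3) have "card S = n" "even n" by auto
      with S(2) have "S = {..<n}" by (simp add: card_subset_eq)
      then have "0 \<in> S" using assms by auto
      \<comment> \<open>Legality gives \<open>p ! 0 \<ge> 1\<close>, so the subtraction is not
        truncated and the parity of the minimum flips.\<close>
      then have "q ! 0 = p ! 0 - 1" "p ! 0 \<ge> 1"
        using S assms remove_tokens_nth_0 by auto
      then show False using \<open>?W q\<close> that \<open>even n\<close> by auto
    qed
  next
    fix p assume p: "p \<in> SN_positions n" and not_W: "\<not> ?W p"
    have len: "length p = n" using p by (simp add: SN_positions_def)
    have move: "SN_move n {1, n} p (remove_tokens n S p) \<and>
        sum_list (remove_tokens n S p) + card S = sum_list p"
      if "S \<subseteq> {..<n}" "card S \<in> {1, n}" "\<forall>i\<in>S. p ! i \<ge> 1" for S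
      using that p sum_list_remove_tokens[OF len] by (auto simp: SN_move_iff)
    show "\<exists>q. SN_move n {1, n} p q \<and> ?W q"
    proof (cases "even n \<and> odd (p ! 0)")
      case True
      \<comment> \<open>As \<open>n\<close> is even, \<open>card ?S\<close> has the parity of
        \<open>sum_list p\<close>, so the new sum is even. Both choices contain 0, so the minimum
        drops by one either way.\<close>
      let ?S = "if even (sum_list p) then {..<n} else {0}"
      have "p ! 0 \<ge> 1" using True by (auto intro: Suc_leI odd_pos)
      then have "p ! i \<ge> 1" if "i < n" for i
        using SN_positions_nth_0_le[OF p that] by linarith
      then have "\<forall>i\<in>?S. p ! i \<ge> 1"
        using assms by auto
      then have "SN_move n {1, n} p (remove_tokens n ?S p)"
        and sum: "sum_list (remove_tokens n ?S p) + card ?S = sum_list p"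
        using move[of ?S] assms by auto
      moreover have "remove_tokens n ?S p ! 0 = p ! 0 - 1"
        using assms p by (intro remove_tokens_nth_0) auto
      moreover have "even (sum_list (remove_tokens n ?S p))"
        using arg_cong[OF sum, of even] True by (auto split: if_splits)
      ultimately show ?thesis using True by (intro exI[of _ "remove_tokens n ?S p"]) simp
    next
      case False
      with not_W have odd_sum: "odd (sum_list p)" by blast
      \<comment> \<open>If all heights were even, 2 would divide their sum.\<close>
      then obtain i where i: "i < n" "odd (p ! i)"
        unfolding sum_list_sum_nth len using dvd_sum[of "{0..<n}" 2 "(!) p"] by auto
      have m: "SN_move n {1, n} p (remove_tokens n {i} p)"
        and sum: "sum_list (remove_tokens n {i} p) + 1 = sum_list p"
        using move[of "{i}"] i by (auto intro: Suc_leI odd_pos)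
      have "even (remove_tokens n {i} p ! 0)" if "even n"
      proof -
        have "even (p ! 0)" using that False by blast
        \<comment> \<open>The parities differ, so the minimum is not attained at
          \<open>i\<close>.\<close>
        then have "p ! 0 < p ! i"
          using i SN_positions_nth_0_le[OF p i(1)] by (metis le_neq_implies_less)
        then show ?thesis
          using \<open>even (p ! 0)\<close> remove_token_nth_0_nonminimal[OF p i(1)] by simp
      qed
      with m sum odd_sum show ?thesis
        by (intro exI[of _ "remove_tokens n {i} p"]) presburger
    qed
  qed (use that in simp)
  then show ?thesis by (auto simp: SN_P_positions_def)
qed

theorem theorem7:
  fixes n :: nat
  assumes "n \<ge> 1"
  shows "(odd n \<longrightarrow>
            SN_P_positions n {1, n} = {p \<in> SN_positions n. even (sum_list p)}) \<and>
         (even n \<longrightarrow>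
            SN_P_positions n {1, n} = {p \<in> SN_positions n. even (sum_list p) \<and> even (p ! 0)})"
  using SN_P_positions_1_n[OF assms] by simp

end
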